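(* Let $1\le r<\infty$, $1\le\sigma<\infty$, and let $\rho:\mathbb{R}^d\to[0,+\infty)$ be a convex function. Suppose that for every $\boldsymbol\beta\in\mathbb{R}^d$ there exists a subgradient $\boldsymbol\beta^*\in\partial\rho(\boldsymbol\beta)$ such that $$\left|\boldsymbol\gamma^\top\left(\boldsymbol\beta^*-\frac{\boldsymbol\beta}{\boldsymbol\beta^\top\boldsymbol\beta}\,\rho^*(\boldsymbol\beta^* )\right)\right|\le\rho(\boldsymbol\gamma)\qquad\text{for all }\boldsymbol\gamma\in\mathbb{R}^d,$$ where for $\boldsymbol\beta=0$ the term $\frac{\boldsymbol\beta}{\boldsymbol\beta^\top\boldsymbol\beta}\rho^*(\boldsymbol\beta^* )$ is read as $0$. Let $\mathbb{P}\in\mathcal{P}_r(\mathbb{R}^{d+1})$. Then, for every $\delta\ge0$ and every $\boldsymbol\beta\in\mathbb{R}^d$, $$\sup_{\widetilde{\mathbb{P}}\in B_\delta(\mathbb{P})}\mathbb{E}_{\widetilde{\mathbb{P}}}\left[|Y-\mathbf{X}^\top\boldsymbol\beta|^r\right]=\left(\left(\mathbb{E}_{\mathbb{P}}\left[|Y-\mathbf{X}^\top\boldsymbol\beta|^r\right]\right)^{1/r}+\delta\,(\sigma+\rho(\boldsymbol\beta))\right)^r.$$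
   Context: $\mathcal{P}_r(\mathbb{R}^{d+1})$ is the set of Borel probability measures on $\mathbb{R}^{d+1}$ with finite $r$-th moment. Points of $\mathbb{R}^{d+1}$ are written $(\mathbf{x},y)$ with $\mathbf{x}\in\mathbb{R}^d$, $y\in\mathbb{R}$; $\mathbb{E}_{\mathbb{Q}}$ denotes expectation when $(\mathbf{X},Y)\sim\mathbb{Q}$. $\Pi(\mathbb{P},\widetilde{\mathbb{P}})$ is the set of couplings, i.e. joint laws of $((\mathbf{X},Y),(\widetilde{\mathbf{X}},\widetilde{Y}))$ with marginals $\mathbb{P}$ and $\widetilde{\mathbb{P}}$. The $\rho$-max-sliced Wasserstein distance is $$\widehat{\mathcal{W}}_{r,\rho,\sigma}(\mathbb{P},\widetilde{\mathbb{P}})=\sup_{\boldsymbol\gamma\in\mathbb{R}^d}\ \inf_{\pi\in\Pi(\mathbb{P},\widetilde{\mathbb{P}})}\frac{1}{\sigma+\rho(\boldsymbol\gamma)}\left(\mathbb{E}_\pi\left[\left|(Y-\mathbf{X}^\top\boldsymbol\gamma)-(\widetilde{Y}-\widetilde{\mathbf{X}}^\top\boldsymbol\gamma)\right|^r\right]\right)^{1/r},$$ and $B_\delta(\mathbb{P})=\{\mathbb{Q}\in\mathcal{P}_r(\mathbb{R}^{d+1}):\widehat{\mathcal{W}}_{r,\rho,\sigma}(\mathbb{Q},\mathbb{P})\le\delta\}$. $\rho^*(\mathbf{b})=\sup_{\mathbf{x}\in\mathbb{R}^d}\{\mathbf{b}^\top\mathbf{x}-\rho(\mathbf{x})\}$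 is the convex conjugate and $\partial\rho(\boldsymbol\beta)=\{\mathbf{b}:\rho(\mathbf{x})\ge\rho(\boldsymbol\beta)+\mathbf{b}^\top(\mathbf{x}-\boldsymbol\beta)\ \forall\mathbf{x}\in\mathbb{R}^d\}$ is the subdifferential. *)

theory Defs
  imports "HOL-Probability.Probability"
begin

text \<open>A point \<open>(x, y)\<close> of (d+1)-dimensional space is an element of \<open>(real ^ 'd) \<times> real\<close>, whose
  norm is the Euclidean one.\<close>

definition finite_moment_measures :: "real \<Rightarrow> 'a::euclidean_space measure set" where
  "finite_moment_measures r =
     {Q. prob_space Q \<and> sets Q = sets borel \<and> integrable Q (\<lambda>z. norm z powr r)}"

definition residual :: "real ^ 'd \<Rightarrow> (real ^ 'd) \<times> real \<Rightarrow> real" where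
  "residual \<gamma> z = snd z - fst z \<bullet> \<gamma>"

definition couplings ::
  "'a::euclidean_space measure \<Rightarrow> 'a measure \<Rightarrow> ('a \<times> 'a) measure set" where
  "couplings P Q =
     {\<pi>. prob_space \<pi> \<and> sets \<pi> = sets borel \<and> distr \<pi> borel fst = P \<and> distr \<pi> borel snd = Q}"

text \<open>The supremum over \<open>\<gamma>\<close> can be infinite, hence the extended reals. The inner expectation is a
  Bochner integral; it is only meant for marginals with finite \<open>r\<close>-th moment, for which the
  integrand is integrable (lemma \<open>integrable_transport_cost\<close> below).\<close>

definition max_sliced_wasserstein ::
  "real \<Rightarrow> (real ^ 'd \<Rightarrow> real) \<Rightarrow> real \<Rightarrow>
   ((real ^ 'd) \<times> real) measure \<Rightarrow> ((real ^ 'd) \<times> real) measure \<Rightarrow> ereal" where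
  "max_sliced_wasserstein r \<rho> \<sigma> P Q =
     (SUP \<gamma>. INF \<pi>\<in>couplings P Q.
        ereal (1 / (\<sigma> + \<rho> \<gamma>) *
          (\<integral>w. \<bar>residual \<gamma> (fst w) - residual \<gamma> (snd w)\<bar> powr r \<partial>\<pi>) powr (1 / r)))"

definition wasserstein_ball ::
  "real \<Rightarrow> (real ^ 'd \<Rightarrow> real) \<Rightarrow> real \<Rightarrow> real \<Rightarrow>
   ((real ^ 'd) \<times> real) measure \<Rightarrow> ((real ^ 'd) \<times> real) measure set" where
  "wasserstein_ball r \<rho> \<sigma> \<delta> P =
     {Q \<in> finite_moment_measures r. max_sliced_wasserstein r \<rho> \<sigma> Q P \<le> ereal \<delta>}"

definition convex_conjugate :: "('a::real_inner \<Rightarrow> real) \<Rightarrow> 'a \<Rightarrow> ereal" where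
  "convex_conjugate \<rho> b = (SUP x. ereal (b \<bullet> x - \<rho> x))"

definition subdifferential :: "('a::real_inner \<Rightarrow> real) \<Rightarrow> 'a \<Rightarrow> 'a set" where
  "subdifferential \<rho> \<beta> = {b. \<forall>x. \<rho> x \<ge> \<rho> \<beta> + b \<bullet> (x - \<beta>)}"

text \<open>The conjugate is finite at every subgradient, so converting it to a real there loses
  nothing.\<close>

lemma convex_conjugate_subgradient:
  assumes "b \<in> subdifferential \<rho> \<beta>"
  shows "convex_conjugate \<rho> b = ereal (b \<bullet> \<beta> - \<rho> \<beta>)"
  unfolding convex_conjugate_def
proof (rule antisym)
  have "b \<bullet> x - \<rho> x \<le> b \<bullet> \<beta> - \<rho> \<beta>" for x
    using assms by (simp add: subdifferential_def inner_diff_right algebra_simps)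
  then show "(SUP x. ereal (b \<bullet> x - \<rho> x)) \<le> ereal (b \<bullet> \<beta> - \<rho> \<beta>)"
    by (intro SUP_least) simp
  show "ereal (b \<bullet> \<beta> - \<rho> \<beta>) \<le> (SUP x. ereal (b \<bullet> x - \<rho> x))"
    by (rule SUP_upper) simp
qed

lemma residual_measurable [measurable]: "residual \<gamma> \<in> borel_measurable borel"
  unfolding residual_def by (intro borel_measurable_continuous_onI continuous_intros)

lemma abs_residual_le: "\<bar>residual \<gamma> z\<bar> \<le> (1 + norm \<gamma>) * norm z"
proof -
  have "\<bar>residual \<gamma> z\<bar> \<le> \<bar>snd z\<bar> + \<bar>fst z \<bullet> \<gamma>\<bar>"
    by (simp add: residual_def)
  also have "\<dots> \<le> norm z + norm z * norm \<gamma>"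
  proof (rule add_mono)
    show "\<bar>snd z\<bar> \<le> norm z"
      using norm_snd_le[of "snd z" "fst z"] by simp
    have "\<bar>fst z \<bullet> \<gamma>\<bar> \<le> norm (fst z) * norm \<gamma>"
      by (rule Cauchy_Schwarz_ineq2)
    also have "\<dots> \<le> norm z * norm \<gamma>"
      using norm_fst_le[of "fst z" "snd z"] by (intro mult_right_mono) auto
    finally show "\<bar>fst z \<bullet> \<gamma>\<bar> \<le> norm z * norm \<gamma>" .
  qed
  finally show ?thesis by (simp add: algebra_simps)
qed

lemma integrable_residual_powr:
  assumes "1 \<le> r" and Q: "Q \<in> finite_moment_measures r"
  shows "integrable Q (\<lambda>z. \<bar>residual \<gamma> z\<bar> powr r)"
proof (rule Bochner_Integration.integrable_bound)
  have [measurable_cong]: "sets Q = sets borel"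
    using Q by (simp add: finite_moment_measures_def)
  show "integrable Q (\<lambda>z. (1 + norm \<gamma>) powr r * norm z powr r)"
    using Q by (simp add: finite_moment_measures_def)
  show "(\<lambda>z. \<bar>residual \<gamma> z\<bar> powr r) \<in> borel_measurable Q"
    by measurable
  have "\<bar>residual \<gamma> z\<bar> powr r \<le> (1 + norm \<gamma>) powr r * norm z powr r" for z
    using powr_mono2[OF _ _ abs_residual_le[of \<gamma> z], of r] \<open>1 \<le> r\<close>
    by (simp add: powr_mult)
  then show "AE z in Q. norm (\<bar>residual \<gamma> z\<bar> powr r)
      \<le> norm ((1 + norm \<gamma>) powr r * norm z powr r)"
    by simp
qed

lemma integrable_transport_cost:
  assumes r: "1 \<le> r" and P: "P \<in> finite_moment_measures r" and Q: "Q \<in> finite_moment_measures r"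
    and \<pi>: "\<pi> \<in> couplings P Q"
  shows "integrable \<pi> (\<lambda>w. \<bar>residual \<gamma> (fst w) - residual \<gamma> (snd w)\<bar> powr r)"
proof (rule Bochner_Integration.integrable_bound)
  let ?a = "\<lambda>w. \<bar>residual \<gamma> (fst w)\<bar>" and ?b = "\<lambda>w. \<bar>residual \<gamma> (snd w)\<bar>"
  have s [measurable_cong]: "sets \<pi> = sets (borel \<Otimes>\<^sub>M borel)"
    using \<pi> by (simp only: couplings_def borel_prod mem_Collect_eq)
  have m: "fst \<in> measurable \<pi> borel" "snd \<in> measurable \<pi> borel"
    by measurable
  have d: "distr \<pi> borel fst = P" "distr \<pi> borel snd = Q"
    using \<pi> by (simp_all add: couplings_def)
  have "integrable \<pi> (\<lambda>w. ?a w powr r)"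
    using integrable_residual_powr[OF r P, of \<gamma>] unfolding d(1)[symmetric]
    by (subst (asm) integrable_distr_eq[OF m(1)]) measurable
  moreover have "integrable \<pi> (\<lambda>w. ?b w powr r)"
    using integrable_residual_powr[OF r Q, of \<gamma>] unfolding d(2)[symmetric]
    by (subst (asm) integrable_distr_eq[OF m(2)]) measurable
  ultimately show "integrable \<pi> (\<lambda>w. 2 powr r * (?a w powr r + ?b w powr r))"
    by simp
  show "(\<lambda>w. \<bar>residual \<gamma> (fst w) - residual \<gamma> (snd w)\<bar> powr r) \<in> borel_measurable \<pi>"
    by measurable
  have "\<bar>residual \<gamma> (fst w) - residual \<gamma> (snd w)\<bar> powr r
      \<le> 2 powr r * (?a w powr r + ?b w powr r)" for w
  proof -
    have "\<bar>residual \<gamma> (fst w) - residual \<gamma> (snd w)\<bar> powr r \<le> (2 * max (?a w) (?b w)) powr r"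
      using r by (intro powr_mono2) auto
    also have "\<dots> = 2 powr r * max (?a w) (?b w) powr r"
      by (simp add: powr_mult)
    also have "\<dots> \<le> 2 powr r * (?a w powr r + ?b w powr r)"
      by (intro mult_left_mono) (auto simp: max_def)
    finally show ?thesis .
  qed
  then show "AE w in \<pi>. norm (\<bar>residual \<gamma> (fst w) - residual \<gamma> (snd w)\<bar> powr r)
      \<le> norm (2 powr r * (?a w powr r + ?b w powr r))"
    by simp
qed

end

theory Submission
  imports Defs
begin

text \<open>
  Write \<open>e\<close> for the residual \<open>Y - X \<bullet> \<beta>\<close> and measure its size by the \<open>L\<^sup>r\<close> norm.

  The supremum cannot exceed the right-hand side because the distance controls the sliced transport
  cost in every direction, in particular in the direction \<open>\<beta>\<close>: along any coupling the
  residuals under the two laws differ in \<open>L\<^sup>r\<close> by that cost, so Minkowski's inequality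
  (\<open>Minkowski_inequality_integral\<close>) moves the norm of the residual by at most
  \<open>\<delta> (\<sigma> + \<rho> \<beta>)\<close> (\<open>residual_norm_le_wasserstein\<close>).

  The bound is attained by an explicit law, the image of \<open>P\<close> under the displacement
  \<open>z \<mapsto> z + s z (u, v)\<close> of every point along one fixed vector \<open>(u, v)\<close>. Such a
  displacement changes the residual in direction \<open>\<gamma>\<close> by \<open>s (v - u \<bullet> \<gamma>)\<close>, so two
  independent choices remain.
  \<^item> The vector must satisfy \<open>\<bar>v - u \<bullet> \<gamma>\<bar> \<le> \<sigma> + \<rho> \<gamma>\<close> for all
    \<open>\<gamma>\<close>, which keeps the image law in the ball, with equality at \<open>\<gamma> = \<beta>\<close>, which
    makes the growth as large as the upper bound permits. The subgradient condition provides it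
    (\<open>extremal_direction\<close>).
  \<^item> The amplitude \<open>s\<close> must have norm \<open>\<delta>\<close> and realise equality in Minkowski's
    inequality with \<open>e\<close>; a nonnegative multiple of \<open>e\<close> does so unless \<open>e\<close> is null,
    when any amplitude of norm \<open>\<delta>\<close> will do (\<open>extremal_amplitude\<close>).
\<close>

section \<open>Minkowski's inequality for real functions\<close>

lemma convex_combination_powr_le:
  fixes x y t r :: real
  assumes r: "1 \<le> r" and t: "0 \<le> t" "t \<le> 1" and xy: "0 \<le> x" "0 \<le> y"
  shows "((1 - t) * x + t * y) powr r \<le> (1 - t) * x powr r + t * y powr r"
proof -
  have scale: "(c * z) powr r \<le> c * z powr r" if "0 \<le> c" "c \<le> 1" for c z :: real
  proof -
    have "c powr r \<le> c powr 1"
      using powr_mono'[of 1 r c] r that by simp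
    then show ?thesis
      using that by (simp add: powr_mult mult_right_mono)
  qed
  show ?thesis
  proof (cases "x = 0 \<or> y = 0")
    case True
    then show ?thesis
      using scale[of t y] scale[of "1 - t" x] r t by auto
  next
    case False
    then show ?thesis
      using convex_onD[OF powr_convex[OF r], of t x y] t xy by simp
  qed
qed

text \<open>Dividing \<open>f\<close> by \<open>a\<close> and \<open>g\<close> by \<open>b\<close> turns \<open>\<bar>f + g\<bar> / (a + b)\<close> into a
  convex combination, to which convexity of the power applies pointwise.\<close>

lemma integral_abs_add_powr_le:
  fixes f g :: "'a \<Rightarrow> real"
  assumes r: "1 \<le> r"
    and meas: "f \<in> borel_measurable M" "g \<in> borel_measurable M"
    and int: "integrable M (\<lambda>x. \<bar>f x\<bar> powr r)" "integrable M (\<lambda>x. \<bar>g x\<bar> powr r)"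
    and ab: "0 < a" "0 < b"
    and le: "(\<integral>x. \<bar>f x\<bar> powr r \<partial>M) \<le> a powr r" "(\<integral>x. \<bar>g x\<bar> powr r \<partial>M) \<le> b powr r"
  shows "(\<integral>x. \<bar>f x + g x\<bar> powr r \<partial>M) \<le> (a + b) powr r"
proof -
  define t where "t = b / (a + b)"
  have t: "0 \<le> t" "t \<le> 1" "1 - t = a / (a + b)"
    using ab by (auto simp: t_def field_simps)
  define h where
    "h = (\<lambda>x. (a + b) powr r *
       ((1 - t) * (\<bar>f x\<bar> powr r / a powr r) + t * (\<bar>g x\<bar> powr r / b powr r)))"
  have int_h: "integrable M h"
    unfolding h_def using int by (intro integrable_mult_right Bochner_Integration.integrable_add) auto
  have pointwise: "\<bar>f x + g x\<bar> powr r \<le> h x" for x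
  proof -
    have "\<bar>f x + g x\<bar> \<le> \<bar>f x\<bar> + \<bar>g x\<bar>" by simp
    also have "\<dots> = (a + b) * ((1 - t) * (\<bar>f x\<bar> / a) + t * (\<bar>g x\<bar> / b))"
      unfolding t(3) using ab by (simp add: t_def distrib_left)
    finally have "\<bar>f x + g x\<bar> powr r
        \<le> ((a + b) * ((1 - t) * (\<bar>f x\<bar> / a) + t * (\<bar>g x\<bar> / b))) powr r"
      using r by (intro powr_mono2) auto
    also have "\<dots> \<le> (a + b) powr r *
        ((1 - t) * (\<bar>f x\<bar> / a) powr r + t * (\<bar>g x\<bar> / b) powr r)"
      unfolding powr_mult[of "a + b"] using r t ab
      by (intro mult_left_mono convex_combination_powr_le) auto
    finally show ?thesis
      by (simp add: h_def powr_divide)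
  qed
  have "integrable M (\<lambda>x. \<bar>f x + g x\<bar> powr r)"
  proof (rule Bochner_Integration.integrable_bound[OF int_h])
    show "(\<lambda>x. \<bar>f x + g x\<bar> powr r) \<in> borel_measurable M"
      using meas by measurable
    show "AE x in M. norm (\<bar>f x + g x\<bar> powr r) \<le> norm (h x)"
      using pointwise by (intro AE_I2) (smt (verit) powr_ge_zero real_norm_def)
  qed
  then have "(\<integral>x. \<bar>f x + g x\<bar> powr r \<partial>M) \<le> (\<integral>x. h x \<partial>M)"
    using int_h pointwise by (rule integral_mono)
  also have "\<dots> = (a + b) powr r * ((1 - t) * ((\<integral>x. \<bar>f x\<bar> powr r \<partial>M) / a powr r)
      + t * ((\<integral>x. \<bar>g x\<bar> powr r \<partial>M) / b powr r))"
    unfolding h_def using int by simp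
  also have "\<dots> \<le> (a + b) powr r * ((1 - t) * 1 + t * 1)"
    using t ab le by (intro mult_left_mono add_mono) (auto simp: divide_le_eq)
  finally show ?thesis by simp
qed

text \<open>The preceding bound needs positive \<open>a\<close> and \<open>b\<close>, whereas either norm may vanish; both are
  therefore enlarged by \<open>\<epsilon>\<close>, which tends to \<open>0\<close>.\<close>

lemma Minkowski_inequality_integral:
  fixes f g :: "'a \<Rightarrow> real"
  assumes r: "1 \<le> r"
    and meas: "f \<in> borel_measurable M" "g \<in> borel_measurable M"
    and int: "integrable M (\<lambda>x. \<bar>f x\<bar> powr r)" "integrable M (\<lambda>x. \<bar>g x\<bar> powr r)"
  shows "(\<integral>x. \<bar>f x + g x\<bar> powr r \<partial>M) powr (1 / r)
    \<le> (\<integral>x. \<bar>f x\<bar> powr r \<partial>M) powr (1 / r) + (\<integral>x. \<bar>g x\<bar> powr r \<partial>M) powr (1 / r)"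
    (is "?N \<le> ?A + ?B")
proof (rule field_le_epsilon)
  fix \<epsilon> :: real
  assume \<epsilon>: "0 < \<epsilon>"
  have norm_le: "I \<le> (I powr (1 / r) + \<epsilon> / 2) powr r" if "0 \<le> I" for I :: real
  proof -
    have "I = (I powr (1 / r)) powr r"
      using r that by (simp add: powr_powr)
    also have "\<dots> \<le> (I powr (1 / r) + \<epsilon> / 2) powr r"
      using r \<epsilon> by (intro powr_mono2) auto
    finally show ?thesis .
  qed
  have "(\<integral>x. \<bar>f x + g x\<bar> powr r \<partial>M) \<le> ((?A + \<epsilon> / 2) + (?B + \<epsilon> / 2)) powr r"
    using \<epsilon> by (intro integral_abs_add_powr_le r meas int norm_le)
      (auto intro: add_nonneg_pos)
  then have "?N \<le> (((?A + \<epsilon> / 2) + (?B + \<epsilon> / 2)) powr r) powr (1 / r)"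
    using r by (intro powr_mono2) auto
  also have "\<dots> = ?A + ?B + \<epsilon>"
    using r \<epsilon> by (simp add: powr_powr)
  finally show "?N \<le> ?A + ?B + \<epsilon>" .
qed

section \<open>Residuals along couplings\<close>

lemma residual_norm_le_coupling:
  assumes r: "1 \<le> r" and Q: "Q \<in> finite_moment_measures r" and P: "P \<in> finite_moment_measures r"
    and \<pi>: "\<pi> \<in> couplings Q P"
  shows "(\<integral>z. \<bar>residual \<gamma> z\<bar> powr r \<partial>Q) powr (1 / r)
    \<le> (\<integral>z. \<bar>residual \<gamma> z\<bar> powr r \<partial>P) powr (1 / r)
      + (\<integral>w. \<bar>residual \<gamma> (fst w) - residual \<gamma> (snd w)\<bar> powr r \<partial>\<pi>) powr (1 / r)"
proof -
  have [measurable_cong]: "sets \<pi> = sets (borel \<Otimes>\<^sub>M borel)"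
    using \<pi> by (simp only: couplings_def borel_prod mem_Collect_eq)
  have m: "fst \<in> measurable \<pi> borel" "snd \<in> measurable \<pi> borel"
    by measurable
  have d: "distr \<pi> borel fst = Q" "distr \<pi> borel snd = P"
    using \<pi> by (simp_all add: couplings_def)
  have int_Q: "(\<integral>z. \<bar>residual \<gamma> z\<bar> powr r \<partial>Q) = (\<integral>w. \<bar>residual \<gamma> (fst w)\<bar> powr r \<partial>\<pi>)"
    unfolding d(1)[symmetric] by (rule integral_distr[OF m(1)]) measurable
  have int_P: "(\<integral>z. \<bar>residual \<gamma> z\<bar> powr r \<partial>P) = (\<integral>w. \<bar>residual \<gamma> (snd w)\<bar> powr r \<partial>\<pi>)"
    unfolding d(2)[symmetric] by (rule integral_distr[OF m(2)]) measurable
  have "integrable \<pi> (\<lambda>w. \<bar>residual \<gamma> (snd w)\<bar> powr r)"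
    using integrable_residual_powr[OF r P, of \<gamma>] unfolding d(2)[symmetric]
    by (subst (asm) integrable_distr_eq[OF m(2)]) measurable
  then have "(\<integral>w. \<bar>residual \<gamma> (snd w) + (residual \<gamma> (fst w) - residual \<gamma> (snd w))\<bar> powr r \<partial>\<pi>)
        powr (1 / r)
      \<le> (\<integral>w. \<bar>residual \<gamma> (snd w)\<bar> powr r \<partial>\<pi>) powr (1 / r)
        + (\<integral>w. \<bar>residual \<gamma> (fst w) - residual \<gamma> (snd w)\<bar> powr r \<partial>\<pi>) powr (1 / r)"
    using integrable_transport_cost[OF r Q P \<pi>]
    by (intro Minkowski_inequality_integral[OF r]) measurable
  then show ?thesis
    unfolding int_Q int_P by simp
qed

lemma residual_norm_le_wasserstein:
  assumes r: "1 \<le> r" and pos: "0 < \<sigma> + \<rho> \<beta>"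
    and P: "P \<in> finite_moment_measures r" and Q: "Q \<in> wasserstein_ball r \<rho> \<sigma> \<delta> P"
  shows "(\<integral>z. \<bar>residual \<beta> z\<bar> powr r \<partial>Q) powr (1 / r)
    \<le> (\<integral>z. \<bar>residual \<beta> z\<bar> powr r \<partial>P) powr (1 / r) + \<delta> * (\<sigma> + \<rho> \<beta>)"
    (is "?B \<le> ?A + _")
proof -
  have Qm: "Q \<in> finite_moment_measures r"
    and dist: "max_sliced_wasserstein r \<rho> \<sigma> Q P \<le> ereal \<delta>"
    using Q by (auto simp: wasserstein_ball_def)
  have "ereal (1 / (\<sigma> + \<rho> \<beta>) * (?B - ?A)) \<le>
      (INF \<pi>\<in>couplings Q P. ereal (1 / (\<sigma> + \<rho> \<beta>) *
        (\<integral>w. \<bar>residual \<beta> (fst w) - residual \<beta> (snd w)\<bar> powr r \<partial>\<pi>) powr (1 / r)))"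
  proof (rule INF_greatest)
    fix \<pi> assume "\<pi> \<in> couplings Q P"
    from residual_norm_le_coupling[OF r Qm P this, of \<beta>]
    show "ereal (1 / (\<sigma> + \<rho> \<beta>) * (?B - ?A)) \<le> ereal (1 / (\<sigma> + \<rho> \<beta>) *
        (\<integral>w. \<bar>residual \<beta> (fst w) - residual \<beta> (snd w)\<bar> powr r \<partial>\<pi>) powr (1 / r))"
      unfolding ereal_less_eq using pos by (intro mult_left_mono) auto
  qed
  also have "\<dots> \<le> max_sliced_wasserstein r \<rho> \<sigma> Q P"
    unfolding max_sliced_wasserstein_def by (rule SUP_upper) simp
  also note dist
  finally show ?thesis
    using pos by (simp add: field_simps)
qed

section \<open>Displacement along a fixed vector\<close>

lemma integral_residual_displacement:
  fixes P :: "((real ^ 'd) \<times> real) measure"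
  assumes sets: "sets P = sets borel" and s [measurable]: "s \<in> borel_measurable borel"
  shows "(\<integral>z. \<bar>residual \<beta> z\<bar> powr r \<partial>distr P borel (\<lambda>z. z + s z *\<^sub>R (u, v)))
    = (\<integral>z. \<bar>residual \<beta> z + s z * (v - u \<bullet> \<beta>)\<bar> powr r \<partial>P)"
proof -
  have [measurable_cong]: "sets P = sets borel" by (rule sets)
  have "(\<integral>z. \<bar>residual \<beta> z\<bar> powr r \<partial>distr P borel (\<lambda>z. z + s z *\<^sub>R (u, v)))
      = (\<integral>z. \<bar>residual \<beta> (z + s z *\<^sub>R (u, v))\<bar> powr r \<partial>P)"
    by (rule integral_distr) measurable
  also have "\<dots> = (\<integral>z. \<bar>residual \<beta> z + s z * (v - u \<bullet> \<beta>)\<bar> powr r \<partial>P)"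
    by (simp add: residual_def inner_add_left algebra_simps)
  finally show ?thesis .
qed

text \<open>The joint law of displaced and original point is a coupling, and its cost in direction
  \<open>\<gamma>\<close> is the norm of \<open>s\<close> scaled by \<open>\<bar>v - u \<bullet> \<gamma>\<bar>\<close>.\<close>

lemma displacement_in_wasserstein_ball:
  fixes P :: "((real ^ 'd) \<times> real) measure"
  assumes r: "1 \<le> r" and \<delta>: "0 \<le> \<delta>" and P: "P \<in> finite_moment_measures r"
    and s [measurable]: "s \<in> borel_measurable borel"
    and int_s: "integrable P (\<lambda>z. \<bar>s z\<bar> powr r)" "(\<integral>z. \<bar>s z\<bar> powr r \<partial>P) = \<delta> powr r"
    and pos: "\<And>\<gamma>. 0 < \<sigma> + \<rho> \<gamma>"
    and dir: "\<And>\<gamma>. \<bar>v - u \<bullet> \<gamma>\<bar> \<le> \<sigma> + \<rho> \<gamma>"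
  shows "distr P borel (\<lambda>z. z + s z *\<^sub>R (u, v)) \<in> wasserstein_ball r \<rho> \<sigma> \<delta> P"
proof -
  define T where "T = (\<lambda>z. z + s z *\<^sub>R (u, v))"
  define \<pi> where "\<pi> = distr P borel (\<lambda>z. (T z, z))"
  have sets [measurable_cong]: "sets P = sets borel" and prob: "prob_space P"
    and int_P: "integrable P (\<lambda>z. norm z powr r)"
    using P by (auto simp: finite_moment_measures_def)
  have T [measurable]: "T \<in> measurable borel borel"
    unfolding T_def by measurable
  have Tm: "T \<in> measurable P borel" by measurable
  have "(\<lambda>z. (T z, z)) \<in> measurable P (borel \<Otimes>\<^sub>M borel)"
    by measurable
  then have pair: "(\<lambda>z. (T z, z)) \<in> measurable P borel"
    by (simp only: borel_prod)
  have "integrable P (\<lambda>z. norm (T z) powr r)"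
  proof (rule Bochner_Integration.integrable_bound)
    show "integrable P (\<lambda>z. 2 powr r *
        (norm z powr r + norm (u, v) powr r * \<bar>s z\<bar> powr r))"
      using int_P int_s(1) by simp
    show "(\<lambda>z. norm (T z) powr r) \<in> borel_measurable P"
      by measurable
    have "norm (T z) powr r \<le> 2 powr r * (norm z powr r + norm (u, v) powr r * \<bar>s z\<bar> powr r)" for z
    proof -
      let ?a = "norm z" and ?b = "norm (u, v) * \<bar>s z\<bar>"
      have "norm (T z) \<le> ?a + ?b"
        unfolding T_def by (metis norm_scaleR norm_triangle_ineq mult.commute)
      then have "norm (T z) powr r \<le> (2 * max ?a ?b) powr r"
        using r by (intro powr_mono2) auto
      also have "\<dots> \<le> 2 powr r * (?a powr r + ?b powr r)"
        unfolding powr_mult[of 2] by (intro mult_left_mono) (auto simp: max_def)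
      finally show ?thesis by (simp add: powr_mult)
    qed
    then show "AE z in P. norm (norm (T z) powr r)
        \<le> norm (2 powr r * (norm z powr r + norm (u, v) powr r * \<bar>s z\<bar> powr r))"
      by simp
  qed
  then have moment: "distr P borel T \<in> finite_moment_measures r"
    by (simp add: finite_moment_measures_def prob_space.prob_space_distr[OF prob Tm]
        integrable_distr_eq[OF Tm])
  have coupling: "\<pi> \<in> couplings (distr P borel T) P"
  proof -
    have "distr \<pi> borel fst = distr P borel T"
      unfolding \<pi>_def by (subst distr_distr[OF _ pair]) (auto simp: comp_def continuous_on_fst continuous_on_id
          intro!: borel_measurable_continuous_onI)
    moreover have "distr \<pi> borel snd = P"
      unfolding \<pi>_def using sets
      by (subst distr_distr[OF _ pair]) (auto simp: comp_def distr_id2 continuous_on_snd continuous_on_id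
          intro!: borel_measurable_continuous_onI)
    ultimately show ?thesis
      using prob_space.prob_space_distr[OF prob pair] by (simp add: couplings_def \<pi>_def)
  qed
  have "max_sliced_wasserstein r \<rho> \<sigma> (distr P borel T) P \<le> ereal \<delta>"
    unfolding max_sliced_wasserstein_def
  proof (rule SUP_least, rule INF_lower2[OF coupling])
    fix \<gamma>
    have shift: "residual \<gamma> (T z) - residual \<gamma> z = s z * (v - u \<bullet> \<gamma>)" for z
      by (simp add: T_def residual_def inner_add_left algebra_simps)
    have "(\<lambda>w. \<bar>residual \<gamma> (fst w) - residual \<gamma> (snd w)\<bar> powr r)
        \<in> borel_measurable (borel \<Otimes>\<^sub>M borel)"
      by measurable
    then have "(\<lambda>w. \<bar>residual \<gamma> (fst w) - residual \<gamma> (snd w)\<bar> powr r) \<in> borel_measurable borel"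
      by (simp only: borel_prod)
    then have "(\<integral>w. \<bar>residual \<gamma> (fst w) - residual \<gamma> (snd w)\<bar> powr r \<partial>\<pi>)
        = (\<integral>z. \<bar>residual \<gamma> (T z) - residual \<gamma> z\<bar> powr r \<partial>P)"
      unfolding \<pi>_def by (subst integral_distr[OF pair]) simp_all
    also have "\<dots> = (\<delta> * \<bar>v - u \<bullet> \<gamma>\<bar>) powr r"
      by (simp add: shift abs_mult powr_mult int_s(2))
    finally have cost: "(\<integral>w. \<bar>residual \<gamma> (fst w) - residual \<gamma> (snd w)\<bar> powr r \<partial>\<pi>) powr (1 / r)
        = \<delta> * \<bar>v - u \<bullet> \<gamma>\<bar>"
      using r \<delta> by (simp add: powr_powr)
    have "\<delta> * \<bar>v - u \<bullet> \<gamma>\<bar> \<le> \<delta> * (\<sigma> + \<rho> \<gamma>)"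
      using \<delta> dir by (intro mult_left_mono) auto
    then show "ereal (1 / (\<sigma> + \<rho> \<gamma>) *
        (\<integral>w. \<bar>residual \<gamma> (fst w) - residual \<gamma> (snd w)\<bar> powr r \<partial>\<pi>) powr (1 / r)) \<le> ereal \<delta>"
      unfolding cost using pos[of \<gamma>] by (simp add: field_simps)
  qed
  with moment show ?thesis
    by (simp add: wasserstein_ball_def T_def)
qed

section \<open>The extremal direction and amplitude\<close>

text \<open>By the equality case of Fenchel's inequality, \<open>\<rho>\<^sup>* b' = b' \<bullet> \<beta> - \<rho> \<beta>\<close> for a
  subgradient \<open>b'\<close> at \<open>\<beta>\<close>. Subtracting \<open>\<rho>\<^sup>* b' / (\<beta> \<bullet> \<beta>) \<beta>\<close> from
  \<open>b'\<close> thus gives a linear form with value exactly \<open>\<rho> \<beta>\<close> at \<open>\<beta>\<close>, and it is this form that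
  the hypothesis bounds by \<open>\<rho>\<close>. At \<open>\<beta> = 0\<close> every linear form vanishes, and
  \<open>\<rho> 0\<close> has to be supplied by the constant \<open>v\<close> instead; the upper bound on
  \<open>v - u \<bullet> \<gamma>\<close> is then the subgradient inequality at \<open>0\<close>, and only the lower bound uses
  the hypothesis.\<close>

lemma extremal_direction:
  fixes \<rho> :: "'a::real_inner \<Rightarrow> real"
  assumes \<sigma>: "0 \<le> \<sigma>" and nonneg: "\<And>x. 0 \<le> \<rho> x"
    and b': "b' \<in> subdifferential \<rho> \<beta>"
    and bound: "\<And>\<gamma>. \<bar>\<gamma> \<bullet> (b' -
      (real_of_ereal (convex_conjugate \<rho> b') / (\<beta> \<bullet> \<beta>)) *\<^sub>R \<beta>)\<bar> \<le> \<rho> \<gamma>"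
  obtains u v where "\<And>\<gamma>. \<bar>v - u \<bullet> \<gamma>\<bar> \<le> \<sigma> + \<rho> \<gamma>"
    and "v - u \<bullet> \<beta> = \<sigma> + \<rho> \<beta>"
proof (cases "\<beta> = 0")
  case True
  have "\<rho> 0 + b' \<bullet> \<gamma> \<le> \<rho> \<gamma>" "\<bar>\<gamma> \<bullet> b'\<bar> \<le> \<rho> \<gamma>" for \<gamma>
    using b' bound[of \<gamma>] True by (auto simp: subdifferential_def)
  then have "\<bar>(\<sigma> + \<rho> 0) - (- b') \<bullet> \<gamma>\<bar> \<le> \<sigma> + \<rho> \<gamma>" for \<gamma>
    using \<sigma> nonneg[of 0] by (smt (verit) inner_commute inner_minus_left)
  then show thesis
    using True by (intro that[of "\<sigma> + \<rho> 0" "- b'"]) auto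
next
  case False
  define w where "w = b' - (real_of_ereal (convex_conjugate \<rho> b') / (\<beta> \<bullet> \<beta>)) *\<^sub>R \<beta>"
  have "w \<bullet> \<beta> = \<rho> \<beta>"
    using False by (simp add: w_def convex_conjugate_subgradient[OF b'] inner_diff_left)
  moreover have "\<bar>w \<bullet> \<gamma>\<bar> \<le> \<rho> \<gamma>" for \<gamma>
    using bound[of \<gamma>] by (simp add: w_def inner_commute)
  then have "\<bar>\<sigma> + w \<bullet> \<gamma>\<bar> \<le> \<sigma> + \<rho> \<gamma>" for \<gamma>
    using \<sigma> by (smt (verit))
  ultimately show thesis
    by (intro that[of \<sigma> "- w"]) auto
qed

text \<open>The amplitude is \<open>e\<close> rescaled to norm \<open>\<delta>\<close>. If \<open>e\<close> vanishes almost everywhere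
  there is nothing to rescale, but then no alignment is required either and the constant
  \<open>\<delta>\<close> serves, having norm \<open>\<delta>\<close> on a probability space.\<close>

lemma (in prob_space) extremal_amplitude:
  fixes e :: "'a \<Rightarrow> real"
  assumes r: "1 \<le> r" and \<delta>: "0 \<le> \<delta>" and c: "0 \<le> c"
    and int_e: "integrable M (\<lambda>z. \<bar>e z\<bar> powr r)"
    and e: "e \<in> borel_measurable N" and MN: "sets M = sets N"
  obtains s where "s \<in> borel_measurable N"
    and "integrable M (\<lambda>z. \<bar>s z\<bar> powr r)" and "(\<integral>z. \<bar>s z\<bar> powr r \<partial>M) = \<delta> powr r"
    and "(\<integral>z. \<bar>e z + s z * c\<bar> powr r \<partial>M)
      = ((\<integral>z. \<bar>e z\<bar> powr r \<partial>M) powr (1 / r) + \<delta> * c) powr r"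
proof (cases "(\<integral>z. \<bar>e z\<bar> powr r \<partial>M) = 0")
  case True
  have [measurable]: "e \<in> borel_measurable M"
    using e measurable_cong_sets[OF MN refl] by blast
  have "AE z in M. \<bar>e z\<bar> powr r = 0"
    using True integral_nonneg_eq_0_iff_AE[OF int_e] by simp
  then have "AE z in M. e z = 0"
    by eventually_elim simp
  then have "(\<integral>z. \<bar>e z + \<delta> * c\<bar> powr r \<partial>M) = (\<integral>z. (\<delta> * c) powr r \<partial>M)"
    using \<delta> c by (intro integral_cong_AE) (auto elim!: eventually_mono)
  then have "(\<integral>z. \<bar>e z + \<delta> * c\<bar> powr r \<partial>M)
      = ((\<integral>z. \<bar>e z\<bar> powr r \<partial>M) powr (1 / r) + \<delta> * c) powr r"
    unfolding True by (simp add: prob_space)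
  then show thesis
    using \<delta> by (intro that[of "\<lambda>_. \<delta>"]) (auto simp: prob_space)
next
  case False
  define A where "A = (\<integral>z. \<bar>e z\<bar> powr r \<partial>M) powr (1 / r)"
  have "0 \<le> (\<integral>z. \<bar>e z\<bar> powr r \<partial>M)" by simp
  with False have A: "0 < A" "(\<integral>z. \<bar>e z\<bar> powr r \<partial>M) = A powr r"
    using r by (auto simp: A_def powr_powr)
  define s where "s = (\<lambda>z. \<delta> / A * e z)"
  have scaled: "\<bar>a * e z\<bar> powr r = a powr r * \<bar>e z\<bar> powr r" if "0 \<le> a" for a z
    using that by (simp add: abs_mult powr_mult)
  have s_eq: "\<bar>s z\<bar> powr r = (\<delta> / A) powr r * \<bar>e z\<bar> powr r" for z
    unfolding s_def using \<delta> A(1) by (intro scaled) simp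
  have sum_eq: "\<bar>e z + s z * c\<bar> powr r = (1 + \<delta> / A * c) powr r * \<bar>e z\<bar> powr r" for z
  proof -
    have "e z + s z * c = (1 + \<delta> / A * c) * e z"
      by (simp add: s_def algebra_simps)
    then show ?thesis
      using \<delta> A(1) c by (simp only:) (intro scaled, simp)
  qed
  show thesis
  proof (rule that[of s])
    show "s \<in> borel_measurable N"
      unfolding s_def using e by measurable
    show "integrable M (\<lambda>z. \<bar>s z\<bar> powr r)"
      unfolding s_eq using int_e by simp
    show "(\<integral>z. \<bar>s z\<bar> powr r \<partial>M) = \<delta> powr r"
      unfolding s_eq using A by (simp add: powr_divide)
    have "(\<integral>z. \<bar>e z + s z * c\<bar> powr r \<partial>M) = ((1 + \<delta> / A * c) * A) powr r"
      unfolding sum_eq powr_mult using A by simp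
    also have "(1 + \<delta> / A * c) * A = A + \<delta> * c"
      using A(1) by (simp add: field_simps)
    finally show "(\<integral>z. \<bar>e z + s z * c\<bar> powr r \<partial>M)
        = ((\<integral>z. \<bar>e z\<bar> powr r \<partial>M) powr (1 / r) + \<delta> * c) powr r"
      by (simp add: A_def)
  qed
qed

section \<open>The worst-case expectation over the ball\<close>

(* For \<beta> = 0 the correction term is 0 by the conventions 1 / 0 = 0 and c *\<^sub>R 0 = 0. *)
theorem theorem1:
  fixes r \<sigma> \<delta> :: real
    and \<rho> :: "real ^ 'd \<Rightarrow> real"
    and P :: "((real ^ 'd) \<times> real) measure"
    and \<beta> :: "real ^ 'd"
  assumes "1 \<le> r" and "1 \<le> \<sigma>"
    and "\<And>x. 0 \<le> \<rho> x"
    and "convex_on UNIV \<rho>"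
    and "\<And>b. \<exists>b' \<in> subdifferential \<rho> b. \<forall>\<gamma>.
           \<bar>\<gamma> \<bullet> (b' - (real_of_ereal (convex_conjugate \<rho> b') / (b \<bullet> b)) *\<^sub>R b)\<bar> \<le> \<rho> \<gamma>"
    and "P \<in> finite_moment_measures r"
    and "0 \<le> \<delta>"
  shows "(SUP Q \<in> wasserstein_ball r \<rho> \<sigma> \<delta> P. ereal (\<integral>z. \<bar>residual \<beta> z\<bar> powr r \<partial>Q)) =
         ereal (((\<integral>z. \<bar>residual \<beta> z\<bar> powr r \<partial>P) powr (1 / r) + \<delta> * (\<sigma> + \<rho> \<beta>)) powr r)"
proof (rule antisym)
  let ?A = "(\<integral>z. \<bar>residual \<beta> z\<bar> powr r \<partial>P) powr (1 / r)"
  have pos: "0 < \<sigma> + \<rho> \<gamma>" for \<gamma>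
    using assms(2) assms(3)[of \<gamma>] by simp
  show "(SUP Q \<in> wasserstein_ball r \<rho> \<sigma> \<delta> P. ereal (\<integral>z. \<bar>residual \<beta> z\<bar> powr r \<partial>Q))
      \<le> ereal ((?A + \<delta> * (\<sigma> + \<rho> \<beta>)) powr r)"
  proof (rule SUP_least)
    fix Q assume "Q \<in> wasserstein_ball r \<rho> \<sigma> \<delta> P"
    from residual_norm_le_wasserstein[OF \<open>1 \<le> r\<close> pos assms(6) this]
    have "((\<integral>z. \<bar>residual \<beta> z\<bar> powr r \<partial>Q) powr (1 / r)) powr r
        \<le> (?A + \<delta> * (\<sigma> + \<rho> \<beta>)) powr r"
      using \<open>1 \<le> r\<close> by (intro powr_mono2) auto
    then show "ereal (\<integral>z. \<bar>residual \<beta> z\<bar> powr r \<partial>Q)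
        \<le> ereal ((?A + \<delta> * (\<sigma> + \<rho> \<beta>)) powr r)"
      using \<open>1 \<le> r\<close> by (simp add: powr_powr)
  qed
  obtain b' where b': "b' \<in> subdifferential \<rho> \<beta>" "\<And>\<gamma>. \<bar>\<gamma> \<bullet> (b' -
      (real_of_ereal (convex_conjugate \<rho> b') / (\<beta> \<bullet> \<beta>)) *\<^sub>R \<beta>)\<bar> \<le> \<rho> \<gamma>"
    using assms(5)[of \<beta>] by blast
  have "0 \<le> \<sigma>" using assms(2) by simp
  then obtain u v where dir: "\<And>\<gamma>. \<bar>v - u \<bullet> \<gamma>\<bar> \<le> \<sigma> + \<rho> \<gamma>"
    and eq: "v - u \<bullet> \<beta> = \<sigma> + \<rho> \<beta>"
    by (rule extremal_direction[OF _ assms(3) b']) (rule that)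
  have sets: "sets P = sets borel" and prob: "prob_space P"
    using assms(6) by (auto simp: finite_moment_measures_def)
  obtain s where s: "s \<in> borel_measurable borel"
      "integrable P (\<lambda>z. \<bar>s z\<bar> powr r)" "(\<integral>z. \<bar>s z\<bar> powr r \<partial>P) = \<delta> powr r"
    and attained: "(\<integral>z. \<bar>residual \<beta> z + s z * (\<sigma> + \<rho> \<beta>)\<bar> powr r \<partial>P)
      = (?A + \<delta> * (\<sigma> + \<rho> \<beta>)) powr r"
    by (rule prob_space.extremal_amplitude[OF prob \<open>1 \<le> r\<close> \<open>0 \<le> \<delta>\<close> less_imp_le[OF pos]
        integrable_residual_powr[OF \<open>1 \<le> r\<close> assms(6)] residual_measurable sets])
  let ?Q = "distr P borel (\<lambda>z. z + s z *\<^sub>R (u, v))"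
  have "?Q \<in> wasserstein_ball r \<rho> \<sigma> \<delta> P"
    by (rule displacement_in_wasserstein_ball[OF \<open>1 \<le> r\<close> \<open>0 \<le> \<delta>\<close> assms(6) s pos dir])
  moreover have "(\<integral>z. \<bar>residual \<beta> z\<bar> powr r \<partial>?Q) = (?A + \<delta> * (\<sigma> + \<rho> \<beta>)) powr r"
    unfolding integral_residual_displacement[OF sets s(1)] eq by (rule attained)
  ultimately show "ereal ((?A + \<delta> * (\<sigma> + \<rho> \<beta>)) powr r)
      \<le> (SUP Q \<in> wasserstein_ball r \<rho> \<sigma> \<delta> P. ereal (\<integral>z. \<bar>residual \<beta> z\<bar> powr r \<partial>Q))"
    by (intro SUP_upper2[of ?Q]) auto
qed

end
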